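(* Let $(L,[\cdot,\cdot])$ be a finite-dimensional Lie algebra over $\Bbbk$ and let $N\in\operatorname{End}(L)$ be a linear map satisfying $N^2=0$, $[N(L),N(L)]=0$ and $N([N(L),L])=0$. Define $x\circ_N y:=N([x,y])-[N(x),y]$ for $x,y\in L$. Then $(L,\circ_N,[\cdot,\cdot])$ is a GD algebra.
   Context: $\Bbbk$ is an algebraically closed field of characteristic $0$. A Novikov algebra is a vector space with a bilinear product $\circ$ satisfying $(x\circ y)\circ z-x\circ(y\circ z)=(y\circ x)\circ z-y\circ(x\circ z)$ and $(x\circ y)\circ z=(x\circ z)\circ y$. A Gelfand--Dorfman (GD) algebra is a triple $(A,\circ,[\cdot,\cdot])$ such that $(A,\circ)$ is a Novikov algebra, $(A,[\cdot,\cdot])$ is a Lie algebra, and for all $x,y,z\in A$: $[x,y\circ z]-[z,y\circ x]+[y,x]\circ z-[y,z]\circ x-y\circ[x,z]=0$. *)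

theory Defs
  imports Complex_Main "HOL-Computational_Algebra.Polynomial"
begin

text \<open>
  The underlying vector space of an algebra is a whole type \<open>'a\<close>, with scalar
  multiplication \<open>scale\<close> by a field \<open>'k\<close>.
\<close>

locale bilinear_product = vector_space scale
  for scale :: "'k::field \<Rightarrow> 'a::ab_group_add \<Rightarrow> 'a" +
  fixes mult :: "'a \<Rightarrow> 'a \<Rightarrow> 'a"
  assumes linear_mult_left: "Vector_Spaces.linear scale scale (\<lambda>x. mult x y)"
    and linear_mult_right: "Vector_Spaces.linear scale scale (\<lambda>y. mult x y)"

locale lie_algebra = bilinear_product scale bracket
  for scale :: "'k::field \<Rightarrow> 'a::ab_group_add \<Rightarrow> 'a"
    and bracket :: "'a \<Rightarrow> 'a \<Rightarrow> 'a" +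
  assumes bracket_self: "bracket x x = 0"
    and jacobi: "bracket x (bracket y z) + bracket y (bracket z x) + bracket z (bracket x y) = 0"

locale novikov_algebra = bilinear_product scale circ
  for scale :: "'k::field \<Rightarrow> 'a::ab_group_add \<Rightarrow> 'a"
    and circ :: "'a \<Rightarrow> 'a \<Rightarrow> 'a" (infixl "\<circ>\<^sub>A" 70) +
  assumes left_symmetric:
      "(x \<circ>\<^sub>A y) \<circ>\<^sub>A z - x \<circ>\<^sub>A (y \<circ>\<^sub>A z) = (y \<circ>\<^sub>A x) \<circ>\<^sub>A z - y \<circ>\<^sub>A (x \<circ>\<^sub>A z)"
    and right_commutative: "(x \<circ>\<^sub>A y) \<circ>\<^sub>A z = (x \<circ>\<^sub>A z) \<circ>\<^sub>A y"

locale gelfand_dorfman_algebra =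
  novikov_algebra scale circ + lie_algebra scale bracket
  for scale :: "'k::field \<Rightarrow> 'a::ab_group_add \<Rightarrow> 'a"
    and circ :: "'a \<Rightarrow> 'a \<Rightarrow> 'a" (infixl "\<circ>\<^sub>A" 70)
    and bracket :: "'a \<Rightarrow> 'a \<Rightarrow> 'a" +
  assumes compatibility:
    "bracket x (y \<circ>\<^sub>A z) - bracket z (y \<circ>\<^sub>A x) + bracket y x \<circ>\<^sub>A z
       - bracket y z \<circ>\<^sub>A x - y \<circ>\<^sub>A bracket x z = 0"

text \<open>
  The bracket \<open>[U, V]\<close> of two subspaces is the linear span of all brackets of their elements.
\<close>

definition bracket_span ::
  "('k::field \<Rightarrow> 'a::ab_group_add \<Rightarrow> 'a) \<Rightarrow> ('a \<Rightarrow> 'a \<Rightarrow> 'a) \<Rightarrow> 'a set \<Rightarrow> 'a set \<Rightarrow> 'a set"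
  where "bracket_span scale bracket U V = module.span scale {bracket u v |u v. u \<in> U \<and> v \<in> V}"

definition circ_N :: "('a::ab_group_add \<Rightarrow> 'a \<Rightarrow> 'a) \<Rightarrow> ('a \<Rightarrow> 'a) \<Rightarrow> 'a \<Rightarrow> 'a \<Rightarrow> 'a"
  where "circ_N bracket N x y = N (bracket x y) - bracket (N x) y"

end

theory Submission
  imports Defs
begin

text \<open>
  Write \<open>x \<circ> y = N [x, y] - [N x, y]\<close>; this is the defect of \<open>N\<close> from commuting with the right
  bracket by \<open>y\<close>.  Two observations make the proposition true.

  The compatibility between \<open>\<circ>\<close> and the bracket holds for an arbitrary linear map \<open>N\<close>.  After
  expansion, the terms in which \<open>N\<close> acts on an inner bracket cancel by antisymmetry, the terms
  in which \<open>N\<close> is applied last form \<open>N\<close> of a Jacobi sum, and the terms in which \<open>N\<close> acts on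
  the single element \<open>y\<close> form a Jacobi sum with entry \<open>N y\<close>.

  The hypotheses on \<open>N\<close> serve the Novikov identities.  They say that \<open>N\<close> kills every product
  \<open>x \<circ> y\<close>, and that most terms in a twofold product vanish, which leaves
  \<open>(x \<circ> y) \<circ> z = - N [[N x, y], z]\<close> and \<open>x \<circ> (y \<circ> z) = N [[N y, z], x] + [N x, [N y, z]]\<close>.
  Since \<open>N\<close> kills \<open>[N x, L]\<close>, the expression \<open>N [[N x, y], z]\<close> is symmetric in \<open>y\<close> and \<open>z\<close> by the
  Jacobi identity, and since \<open>[N x, N y] = 0\<close>, so is \<open>[N x, [N y, z]]\<close> in \<open>x\<close> and \<open>y\<close>.
  Right commutativity and left symmetry follow from these two symmetries.
\<close>

lemma (in bilinear_product)
  shows mult_add_left: "mult (x + y) z = mult x z + mult y z"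
    and mult_add_right: "mult x (y + z) = mult x y + mult x z"
    and mult_scale_left: "mult (scale c x) z = scale c (mult x z)"
    and mult_scale_right: "mult x (scale c z) = scale c (mult x z)"
    and mult_zero_left: "mult 0 z = 0"
    and mult_minus_right: "mult x (- z) = - mult x z"
    and mult_diff_left: "mult (x - y) z = mult x z - mult y z"
    and mult_diff_right: "mult x (y - z) = mult x y - mult x z"
proof -
  interpret L: Vector_Spaces.linear scale scale "\<lambda>x. mult x z" for z
    by (rule linear_mult_left)
  interpret R: Vector_Spaces.linear scale scale "\<lambda>z. mult x z" for x
    by (rule linear_mult_right)
  show "mult (x + y) z = mult x z + mult y z" by (rule L.add)
  show "mult x (y + z) = mult x y + mult x z" by (rule R.add)
  show "mult (scale c x) z = scale c (mult x z)" by (rule L.scale)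
  show "mult x (scale c z) = scale c (mult x z)" by (rule R.scale)
  show "mult 0 z = 0" by (rule L.zero)
  show "mult x (- z) = - mult x z" by (rule R.neg)
  show "mult (x - y) z = mult x z - mult y z" by (rule L.diff)
  show "mult x (y - z) = mult x y - mult x z" by (rule R.diff)
qed

context lie_algebra
begin

lemma bracket_antisym: "bracket x y = - bracket y x"
proof -
  have "0 = bracket (x + y) (x + y)" by (rule bracket_self[symmetric])
  also have "\<dots> = bracket x x + bracket x y + (bracket y x + bracket y y)"
    by (simp only: mult_add_left mult_add_right add.assoc add.left_commute)
  finally have "bracket x y + bracket y x = 0"
    by (simp add: bracket_self)
  then show ?thesis by (simp only: eq_neg_iff_add_eq_0)
qed

lemma bracket_derivation:
  "bracket x (bracket y z) = bracket (bracket x y) z + bracket y (bracket x z)"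
proof -
  have "bracket y (bracket z x) = - bracket y (bracket x z)"
    using bracket_antisym[of z x] by (simp add: mult_minus_right)
  moreover have "bracket z (bracket x y) = - bracket (bracket x y) z"
    by (rule bracket_antisym)
  ultimately show ?thesis
    using jacobi[of x y z] by (simp add: algebra_simps)
qed

end

locale lie_algebra_endomorphism = lie_algebra scale bracket
  for scale :: "'k::field \<Rightarrow> 'a::ab_group_add \<Rightarrow> 'a"
    and bracket :: "'a \<Rightarrow> 'a \<Rightarrow> 'a" +
  fixes N :: "'a \<Rightarrow> 'a"
  assumes linear_N: "Vector_Spaces.linear scale scale N"
begin

sublocale N: Vector_Spaces.linear scale scale N
  by (rule linear_N)

abbreviation circ (infixl "\<odot>" 70)
  where "circ \<equiv> circ_N bracket N"

lemma bilinear_circ: "bilinear_product scale circ"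
  by unfold_locales
    (simp_all add: circ_N_def mult_add_left mult_add_right mult_scale_left mult_scale_right
      N.add N.scale scale_right_diff_distrib)

text \<open>
  The terms fall into three groups that vanish separately, according to whether \<open>N\<close> is applied
  to an inner bracket, to an outer bracket or to \<open>y\<close>: by antisymmetry, by the Jacobi identity for
  \<open>y\<close>, \<open>x\<close>, \<open>z\<close> under \<open>N\<close>, and by the Jacobi identity for \<open>N y\<close>, \<open>x\<close>, \<open>z\<close>.
\<close>
lemma circ_compatible:
  "bracket x (y \<odot> z) - bracket z (y \<odot> x) + bracket y x \<odot> z - bracket y z \<odot> x
     - y \<odot> bracket x z = 0"
proof -
  have inner: "bracket x (N (bracket y z)) = - bracket (N (bracket y z)) x"
      "bracket z (N (bracket y x)) = - bracket (N (bracket y x)) z"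
    by (rule bracket_antisym)+
  have "bracket y (bracket x z) = bracket (bracket y x) z - bracket (bracket y z) x"
    using bracket_derivation[of y x z] bracket_antisym[of x "bracket y z"] by simp
  then have outer: "N (bracket y (bracket x z))
      = N (bracket (bracket y x) z) - N (bracket (bracket y z) x)"
    by (simp add: N.diff)
  have elem: "bracket (N y) (bracket x z)
      = bracket x (bracket (N y) z) - bracket z (bracket (N y) x)"
    using bracket_derivation[of "N y" x z] bracket_antisym[of z "bracket (N y) x"] by simp
  show ?thesis
    by (simp add: circ_N_def mult_diff_right inner outer elem)
qed

end

locale square_zero_lie_endomorphism = lie_algebra_endomorphism +
  assumes N_N: "N (N x) = 0"
    and bracket_N_N: "bracket (N x) (N y) = 0"
    and N_bracket_N: "N (bracket (N x) y) = 0"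
begin

lemma N_circ: "N (x \<odot> y) = 0"
  by (simp add: circ_N_def N.diff N_N N_bracket_N)

lemma circ_circ_left: "(x \<odot> y) \<odot> z = - N (bracket (bracket (N x) y) z)"
proof -
  have "(x \<odot> y) \<odot> z = N (bracket (x \<odot> y) z)"
    by (simp add: circ_N_def[of bracket N "x \<odot> y"] N_circ mult_zero_left)
  also have "\<dots> = - N (bracket (bracket (N x) y) z)"
    by (simp add: circ_N_def mult_diff_left N.diff N_bracket_N)
  finally show ?thesis .
qed

lemma circ_circ_right:
  "x \<odot> (y \<odot> z) = N (bracket (bracket (N y) z) x) + bracket (N x) (bracket (N y) z)"
proof -
  have "N (bracket x (N (bracket y z))) = 0"
    using bracket_antisym[of x "N (bracket y z)"] by (simp add: N.neg N_bracket_N)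
  moreover have "N (bracket x (bracket (N y) z)) = - N (bracket (bracket (N y) z) x)"
    using bracket_antisym[of x "bracket (N y) z"] by (simp add: N.neg)
  ultimately show ?thesis
    by (simp add: circ_N_def mult_diff_right N.diff bracket_N_N)
qed

text \<open>
  The Jacobi identity turns the difference of the two sides into \<open>N [N x, [y, z]]\<close>,
  and \<open>N\<close> kills \<open>[N x, L]\<close>.
\<close>
lemma N_bracket_bracket_commute:
  "N (bracket (bracket (N x) y) z) = N (bracket (bracket (N x) z) y)"
proof -
  have "bracket (N x) (bracket y z)
      = bracket (bracket (N x) y) z - bracket (bracket (N x) z) y"
    using bracket_derivation[of "N x" y z] bracket_antisym[of y "bracket (N x) z"] by simp
  then have "N (bracket (bracket (N x) y) z - bracket (bracket (N x) z) y) = 0"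
    using N_bracket_N[of x "bracket y z"] by simp
  then show ?thesis by (simp add: N.diff)
qed

lemma bracket_N_bracket_N_commute:
  "bracket (N x) (bracket (N y) z) = bracket (N y) (bracket (N x) z)"
  using bracket_derivation[of "N x" "N y" z] by (simp add: bracket_N_N mult_zero_left)

lemma circ_right_commute: "(x \<odot> y) \<odot> z = (x \<odot> z) \<odot> y"
  unfolding circ_circ_left using N_bracket_bracket_commute[of x y z] by simp

text \<open>
  The associator of \<open>x\<close>, \<open>y\<close>, \<open>z\<close> is \<open>- N [[N x, y], z] - N [[N y, z], x] - [N x, [N y, z]]\<close>.
  Commuting \<open>z\<close> and \<open>x\<close> in the second term gives \<open>N [[N y, x], z]\<close>, so exchanging \<open>x\<close> and \<open>y\<close>
  swaps the first two terms and fixes the third.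
\<close>
lemma circ_left_symmetric:
  "(x \<odot> y) \<odot> z - x \<odot> (y \<odot> z) = (y \<odot> x) \<odot> z - y \<odot> (x \<odot> z)"
  unfolding circ_circ_left circ_circ_right
  using N_bracket_bracket_commute[of y z x] N_bracket_bracket_commute[of x z y]
    bracket_N_bracket_N_commute[of x y z]
  by simp

lemma gelfand_dorfman_circ: "gelfand_dorfman_algebra scale circ bracket"
proof -
  interpret circ: bilinear_product scale circ
    by (rule bilinear_circ)
  show ?thesis
    by unfold_locales (fact circ_left_symmetric circ_right_commute circ_compatible)+
qed

end

theorem proposition5p2:
  fixes scale :: "'k::{alg_closed_field, field_char_0} \<Rightarrow> 'a::ab_group_add \<Rightarrow> 'a"
    and bracket :: "'a \<Rightarrow> 'a \<Rightarrow> 'a"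
    and N :: "'a \<Rightarrow> 'a"
    and B :: "'a set"
  assumes "finite_dimensional_vector_space scale B"
    and "lie_algebra scale bracket"
    and "Vector_Spaces.linear scale scale N"
    and "N \<circ> N = (\<lambda>x. 0)"
    and "bracket_span scale bracket (range N) (range N) = {0}"
    and "N ` bracket_span scale bracket (range N) UNIV = {0}"
  shows "gelfand_dorfman_algebra scale (circ_N bracket N) bracket"
proof -
  interpret lie_algebra_endomorphism scale bracket N
    using assms(2,3)
    by (simp add: lie_algebra_endomorphism_def lie_algebra_endomorphism_axioms_def)
  have bracket_in_span: "bracket u v \<in> bracket_span scale bracket U V"
    if "u \<in> U" "v \<in> V" for u v U V
    unfolding bracket_span_def using that by (blast intro: span_base)
  interpret square_zero_lie_endomorphism scale bracket N
  proof unfold_locales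
    fix x y
    show "N (N x) = 0"
      using fun_cong[OF assms(4), of x] by simp
    show "bracket (N x) (N y) = 0"
      using bracket_in_span[of "N x" "range N" "N y" "range N"] assms(5) by simp
    show "N (bracket (N x) y) = 0"
      using imageI[OF bracket_in_span[of "N x" "range N" y UNIV], of N] assms(6) by simp
  qed
  show ?thesis by (rule gelfand_dorfman_circ)
qed

end
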